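(* Let $m\geq 2$ be a positive integer and let $r,u$ be real numbers with $$2\leq r\leq u<\frac{mr}{m-1}.$$ Then, for any Banach spaces $E_{1},\dots,E_{m},F$ over $\mathbb{K}$, $$\Pi_{(r;r)}^{m}(E_{1},\dots,E_{m};F)\subset\Pi_{\left(\frac{ru}{mr-(m-1)u};u\right)}^{m}(E_{1},\dots,E_{m};F),$$ and the inclusion has norm $1$.
   Context: $\mathbb{K}$ is $\mathbb{R}$ or $\mathbb{C}$. For a Banach space $E$ with closed unit ball $B_{E^*}$ of its dual and $p\in[1,\infty)$, $\ell_p^w(E)$ is the space of sequences $(x_j)_{j\ge1}$ in $E$ with $\|(x_j)\|_{w,p}:=\sup_{\varphi\in B_{E^*}}\left(\sum_{j}|\varphi(x_j)|^p\right)^{1/p}<\infty$. For $q,p\in[1,\infty)$, $\Pi^m_{(q;p)}(E_1,\dots,E_m;F)$ denotes the class of multiple $(q;p)$-summing operators: bounded $m$-linear operators $T\colon E_1\times\cdots\times E_m\to F$ for which there is a constant $C>0$ such that $$\left(\sum_{j_1,\dots,j_m=1}^\infty\left\|T(x^{(1)}_{j_1},\dots,x^{(m)}_{j_m})\right\|^q\right)^{1/q}\le C\prod_{k=1}^m\left\|(x^{(k)}_{j})_{j=1}^\infty\right\|_{w,p}$$ for all $(x^{(k)}_j)_{j}\in\ell_p^w(E_k)$, $k=1,\dots,m$. The infimum of such $C$ is the norm $\pi_{(q;p)}(T)$. The norm of the inclusion is its operator norm with respect to these norms. *)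

theory Defs
  imports "HOL-Analysis.Analysis" "HOL-Algebra.Module"
begin

section \<open>Banach spaces over the reals or the complex numbers\<close>

text \<open>
  The scalar field is a subset \<open>K\<close> of the complex numbers, \<open>K = \<real>\<close> or \<open>K = UNIV\<close>, regarded as a ring
  in the sense of HOL-Algebra. Normed spaces are modules with an explicit carrier and a norm, so that
  a family \<open>E 1, ..., E m\<close> of unrelated Banach spaces is a function on indices: the spaces share a
  type of elements but no part of their structure. (Spaces living on different types can be
  transported to the sum of these types.)  The fields \<open>mult\<close> and \<open>one\<close>, inherited from the
  HOL-Algebra record of modules, play no role.
\<close>

definition scalar_ring :: "complex set \<Rightarrow> complex ring" where
  "scalar_ring K = \<lparr>carrier = K, mult = (*), one = 1, zero = 0, add = (+)\<rparr>"

record 'a normed_module = "(complex, 'a) module" +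
  vnorm :: "'a \<Rightarrow> real"

text \<open>The value off the carrier only serves to meet the conventions of \<^locale>\<open>Metric_space\<close>,
  which wants nonnegativity and symmetry on the whole type.\<close>

definition norm_dist :: "'a normed_module \<Rightarrow> 'a \<Rightarrow> 'a \<Rightarrow> real" where
  "norm_dist E x y =
    (if x \<in> carrier E \<and> y \<in> carrier E then vnorm E (x \<ominus>\<^bsub>E\<^esub> y) else 0)"

locale normed_space = Module.module "scalar_ring K" E
  for K :: "complex set" and E :: "'a normed_module" (structure) +
  assumes vnorm_nonneg: "x \<in> carrier E \<Longrightarrow> 0 \<le> vnorm E x"
    and vnorm_eq_0: "x \<in> carrier E \<Longrightarrow> vnorm E x = 0 \<longleftrightarrow> x = \<zero>\<^bsub>E\<^esub>"
    and vnorm_triangle: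
      "\<lbrakk>x \<in> carrier E; y \<in> carrier E\<rbrakk> \<Longrightarrow> vnorm E (x \<oplus>\<^bsub>E\<^esub> y) \<le> vnorm E x + vnorm E y"
    and vnorm_smult:
      "\<lbrakk>a \<in> K; x \<in> carrier E\<rbrakk> \<Longrightarrow> vnorm E (a \<odot>\<^bsub>E\<^esub> x) = cmod a * vnorm E x"

locale banach_space = normed_space +
  assumes complete: "Metric_space.mcomplete (carrier E) (norm_dist E)"

section \<open>Weakly summable sequences\<close>

text \<open>The closed unit ball of the dual space. Functionals are considered up to their values off the
  carrier.\<close>

definition dual_ball :: "complex set \<Rightarrow> 'a normed_module \<Rightarrow> ('a \<Rightarrow> complex) set" where
  "dual_ball K E = {\<phi> \<in> carrier E \<rightarrow> K.
     (\<forall>x\<in>carrier E. \<forall>y\<in>carrier E. \<phi> (x \<oplus>\<^bsub>E\<^esub> y) = \<phi> x + \<phi> y) \<and>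
     (\<forall>a\<in>K. \<forall>x\<in>carrier E. \<phi> (a \<odot>\<^bsub>E\<^esub> x) = a * \<phi> x) \<and>
     (\<forall>x\<in>carrier E. cmod (\<phi> x) \<le> vnorm E x)}"

text \<open>Sequences are indexed from 0. In \<open>weak_norm\<close>, the sums and the supremum are those of real
  numbers and are meaningful for members of \<open>weak_lp\<close>, where they are required to be finite.\<close>

definition weak_lp :: "complex set \<Rightarrow> 'a normed_module \<Rightarrow> real \<Rightarrow> (nat \<Rightarrow> 'a) set" where
  "weak_lp K E p = {x \<in> UNIV \<rightarrow> carrier E.
     (\<forall>\<phi>\<in>dual_ball K E. summable (\<lambda>j. cmod (\<phi> (x j)) powr p)) \<and>
     bdd_above ((\<lambda>\<phi>. (\<Sum>j. cmod (\<phi> (x j)) powr p) powr (1 / p)) ` dual_ball K E)}"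

definition weak_norm :: "complex set \<Rightarrow> 'a normed_module \<Rightarrow> real \<Rightarrow> (nat \<Rightarrow> 'a) \<Rightarrow> real" where
  "weak_norm K E p x = (SUP \<phi>\<in>dual_ball K E. (\<Sum>j. cmod (\<phi> (x j)) powr p) powr (1 / p))"

section \<open>Multiple summing operators\<close>

text \<open>Elements of \<open>E 1 \<times> ... \<times> E m\<close> are functions in \<open>\<Pi>\<^sub>E k\<in>{1..m}. carrier (E k)\<close>. An operator is
  \<open>undefined\<close> off this set, so that it is determined by its values there.\<close>

definition bounded_multilinear ::
  "complex set \<Rightarrow> nat \<Rightarrow> (nat \<Rightarrow> 'a normed_module) \<Rightarrow> 'b normed_module \<Rightarrow> ((nat \<Rightarrow> 'a) \<Rightarrow> 'b) set"
  where
  "bounded_multilinear K m E F =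
    {T \<in> (\<Pi>\<^sub>E k\<in>{1..m}. carrier (E k)) \<rightarrow>\<^sub>E carrier F.
      (\<forall>x \<in> \<Pi>\<^sub>E k\<in>{1..m}. carrier (E k). \<forall>k\<in>{1..m}.
        (\<forall>y\<in>carrier (E k). \<forall>z\<in>carrier (E k).
          T (x(k := y \<oplus>\<^bsub>E k\<^esub> z)) = T (x(k := y)) \<oplus>\<^bsub>F\<^esub> T (x(k := z))) \<and>
        (\<forall>a\<in>K. \<forall>y\<in>carrier (E k). T (x(k := a \<odot>\<^bsub>E k\<^esub> y)) = a \<odot>\<^bsub>F\<^esub> T (x(k := y)))) \<and>
      (\<exists>C. \<forall>x \<in> \<Pi>\<^sub>E k\<in>{1..m}. carrier (E k). vnorm F (T x) \<le> C * (\<Prod>k=1..m. vnorm (E k) (x k)))}"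

text \<open>\<open>summing_bound K m E F q p T C\<close>: the inequality defining multiple \<open>(q;p)\<close>-summability holds with
  the constant \<open>C\<close>. The sum over all multi-indices \<open>j = (j 1, ..., j m)\<close> is an unordered sum
  of nonnegative reals, whose convergence is part of the condition.\<close>

definition summing_bound ::
  "complex set \<Rightarrow> nat \<Rightarrow> (nat \<Rightarrow> 'a normed_module) \<Rightarrow> 'b normed_module \<Rightarrow> real \<Rightarrow> real \<Rightarrow>
    ((nat \<Rightarrow> 'a) \<Rightarrow> 'b) \<Rightarrow> real \<Rightarrow> bool" where
  "summing_bound K m E F q p T C \<longleftrightarrow>
    (\<forall>x :: nat \<Rightarrow> nat \<Rightarrow> 'a. (\<forall>k\<in>{1..m}. x k \<in> weak_lp K (E k) p) \<longrightarrow>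
      (\<lambda>j. vnorm F (T (\<lambda>k\<in>{1..m}. x k (j k))) powr q) summable_on ({1..m} \<rightarrow>\<^sub>E UNIV) \<and>
      (\<Sum>\<^sub>\<infinity>j\<in>{1..m} \<rightarrow>\<^sub>E UNIV. vnorm F (T (\<lambda>k\<in>{1..m}. x k (j k))) powr q) powr (1 / q)
        \<le> C * (\<Prod>k=1..m. weak_norm K (E k) p (x k)))"

definition multiple_summing ::
  "complex set \<Rightarrow> nat \<Rightarrow> (nat \<Rightarrow> 'a normed_module) \<Rightarrow> 'b normed_module \<Rightarrow> real \<Rightarrow> real \<Rightarrow>
    ((nat \<Rightarrow> 'a) \<Rightarrow> 'b) set" where
  "multiple_summing K m E F q p =
    {T \<in> bounded_multilinear K m E F. \<exists>C>0. summing_bound K m E F q p T C}"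

definition summing_norm ::
  "complex set \<Rightarrow> nat \<Rightarrow> (nat \<Rightarrow> 'a normed_module) \<Rightarrow> 'b normed_module \<Rightarrow> real \<Rightarrow> real \<Rightarrow>
    ((nat \<Rightarrow> 'a) \<Rightarrow> 'b) \<Rightarrow> real" where
  "summing_norm K m E F q p T = Inf {C. C > 0 \<and> summing_bound K m E F q p T C}"

text \<open>The operator norm of the inclusion of the \<open>(q;p)\<close>-class into the \<open>(q';p')\<close>-class, as a
  supremum in \<open>[0, \<infinity>]\<close> over the closed unit ball of the former.\<close>

definition inclusion_norm ::
  "complex set \<Rightarrow> nat \<Rightarrow> (nat \<Rightarrow> 'a normed_module) \<Rightarrow> 'b normed_module \<Rightarrow> real \<Rightarrow> real \<Rightarrow>
    real \<Rightarrow> real \<Rightarrow> ennreal" where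
  "inclusion_norm K m E F q p q' p' =
    (SUP T \<in> {T \<in> multiple_summing K m E F q p. summing_norm K m E F q p T \<le> 1}.
      ennreal (summing_norm K m E F q' p' T))"

section \<open>Consistency of the encoding\<close>

lemma cring_scalar_ring:
  assumes "K = \<real> \<or> K = UNIV"
  shows "cring (scalar_ring K)"
proof -
  have [simp]: "a + b \<in> K" "a * b \<in> K" "- a \<in> K" "0 \<in> K" "1 \<in> K" if "a \<in> K" "b \<in> K" for a b
    using assms that by auto
  have [simp]: "0 \<in> K" "1 \<in> K"
    using assms by auto
  show ?thesis
  proof (rule cringI)
    show "abelian_group (scalar_ring K)"
    proof (rule abelian_groupI)
      fix x assume "x \<in> carrier (scalar_ring K)"
      then show "\<exists>y\<in>carrier (scalar_ring K). y \<oplus>\<^bsub>scalar_ring K\<^esub> x = \<zero>\<^bsub>scalar_ring K\<^esub>"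
        by (intro bexI[of _ "- x"]) (auto simp: scalar_ring_def)
    qed (auto simp: scalar_ring_def)
    show "comm_monoid (scalar_ring K)"
      by (rule comm_monoidI) (auto simp: scalar_ring_def)
  qed (auto simp: scalar_ring_def algebra_simps)
qed

lemma (in normed_space) Metric_space_norm_dist:
  assumes "K = \<real> \<or> K = UNIV"
  shows "Metric_space (carrier E) (norm_dist E)"
proof
  have minus_1: "- 1 \<in> K"
    using assms by auto
  have neg: "vnorm E (\<ominus>\<^bsub>E\<^esub> x) = vnorm E x" if "x \<in> carrier E" for x
  proof -
    have "\<ominus>\<^bsub>scalar_ring K\<^esub> \<one>\<^bsub>scalar_ring K\<^esub> = - 1"
      by (rule R.minus_equality) (use assms in \<open>auto simp: scalar_ring_def\<close>)
    then have "(- 1) \<odot>\<^bsub>E\<^esub> x = \<ominus>\<^bsub>E\<^esub> x"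
      using smult_l_minus[OF R.one_closed that] that by simp
    then show ?thesis
      using vnorm_smult[OF minus_1 that] by simp
  qed
  fix x y z
  show "0 \<le> norm_dist E x y"
    by (simp add: norm_dist_def vnorm_nonneg)
  show "norm_dist E x y = norm_dist E y x"
    using neg[of "x \<ominus>\<^bsub>E\<^esub> y"]
    by (auto simp: norm_dist_def M.minus_add a_minus_def M.a_comm)
  show "norm_dist E x y = 0 \<longleftrightarrow> x = y" if "x \<in> carrier E" "y \<in> carrier E"
  proof -
    have "x \<ominus>\<^bsub>E\<^esub> y = \<zero>\<^bsub>E\<^esub> \<longleftrightarrow> x = y"
      using that M.minus_equality[of x "\<ominus>\<^bsub>E\<^esub> y"] by (auto simp: a_minus_def M.r_neg)
    then show ?thesis
      using that by (simp add: norm_dist_def vnorm_eq_0)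
  qed
  show "norm_dist E x z \<le> norm_dist E x y + norm_dist E y z"
    if "x \<in> carrier E" "y \<in> carrier E" "z \<in> carrier E"
  proof -
    have "x \<ominus>\<^bsub>E\<^esub> z = (x \<ominus>\<^bsub>E\<^esub> y) \<oplus>\<^bsub>E\<^esub> (y \<ominus>\<^bsub>E\<^esub> z)"
      using that by (simp add: a_minus_def M.a_assoc M.r_neg1)
    then show ?thesis
      using that vnorm_triangle[of "x \<ominus>\<^bsub>E\<^esub> y" "y \<ominus>\<^bsub>E\<^esub> z"] by (simp add: norm_dist_def)
  qed
qed

text \<open>A real Banach space in the sense of the class \<^class>\<open>banach\<close>.\<close>

lemma banach_space_UNIV:
  "banach_space \<real> \<lparr>carrier = (UNIV :: 'a::banach set), mult = undefined, one = undefined,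
    zero = 0, add = (+), smult = (\<lambda>a x. Re a *\<^sub>R x), vnorm = norm\<rparr>"
    (is "banach_space _ ?E")
proof -
  have grp: "abelian_group ?E"
  proof (rule abelian_groupI)
    fix x assume "x \<in> carrier ?E"
    show "\<exists>y\<in>carrier ?E. y \<oplus>\<^bsub>?E\<^esub> x = \<zero>\<^bsub>?E\<^esub>"
      by (intro bexI[of _ "- x"]) auto
  qed (auto simp: algebra_simps)
  have "Module.module (scalar_ring \<real>) ?E"
  proof (rule moduleI)
    show "cring (scalar_ring \<real>)"
      by (rule cring_scalar_ring) simp
  qed (use grp in \<open>auto simp: scalar_ring_def scaleR_add_left scaleR_add_right complex_is_Real_iff\<close>)
  then interpret normed_space \<real> ?E
    by (intro normed_space.intro normed_space_axioms.intro)
      (auto simp: norm_triangle_ineq complex_is_Real_iff cmod_eq_Re)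
  have "\<ominus>\<^bsub>?E\<^esub> y = - y" for y
    by (rule M.minus_equality) auto
  then have "norm_dist ?E = dist"
    by (auto simp: fun_eq_iff norm_dist_def a_minus_def dist_norm)
  then show ?thesis
    by unfold_locales (simp add: mcomplete_iff_complete complete_UNIV)
qed

end

theory Submission
  imports Defs
begin

text \<open>
  If \<open>r = u\<close>, there is nothing to prove. Otherwise put \<open>1 / t = 1 / r - 1 / u\<close>. By Hoelder's inequality,
  multiplying a weakly \<open>u\<close>-summable sequence by a scalar sequence of \<open>\<ell>\<^sub>t\<close> gives a weakly \<open>r\<close>-summable
  one. For a finite set \<open>J\<close> of multi-indices and \<open>b\<^sub>j = \<parallel>T x\<^sub>j\<parallel>\<close>, scale the \<open>k\<close>-th sequence at
  position \<open>i\<close> by the \<open>t\<close>-th root of the sum of \<open>b\<^sub>j\<^sup>s\<close> over the \<open>j \<in> J\<close> whose \<open>k\<close>-th entry is \<open>i\<close>.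
  This factor is at least \<open>b\<^sub>j\<close> to the power \<open>s / t\<close>, so that, as \<open>1 / r = 1 / s + m / t\<close>, the
  \<open>r\<close>-summing inequality for the scaled sequences bounds the sum \<open>B\<close> of \<open>b\<^sub>j\<^sup>s\<close> by a multiple of \<open>B\<close> to the
  power \<open>m r / t < 1\<close>, which is the desired inequality with the same constant. The norm 1 is attained
  at the tensor product of norming functionals with a unit vector.
\<close>

section \<open>The Hahn-Banach theorem\<close>

text \<open>A minimal sublinear functional \<open>p\<close> is linear, since it cannot exceed the sublinear functionals
  \<open>directional p y\<close>. Minimal ones below \<open>directional p e\<close> for the norm \<open>p\<close> are norming at \<open>e\<close>.\<close>

locale scalar_normed_space = normed_space +
  assumes scalars: "K = \<real> \<or> K = UNIV"
begin

section \<open>Module arithmetic over \<open>K\<close>\<close>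

lemma of_real_scalar [simp]: "complex_of_real a \<in> K"
  using scalars by auto

lemma minus_one_scalar [simp]: "- 1 \<in> K"
  using scalars by auto

lemma scalar_closed [simp]: "a \<in> K \<Longrightarrow> x \<in> carrier E \<Longrightarrow> a \<odot>\<^bsub>E\<^esub> x \<in> carrier E"
  using smult_closed[of a x] by (simp add: scalar_ring_def)

lemma scalar_distrib_left:
  "a \<in> K \<Longrightarrow> x \<in> carrier E \<Longrightarrow> y \<in> carrier E \<Longrightarrow>
    a \<odot>\<^bsub>E\<^esub> (x \<oplus>\<^bsub>E\<^esub> y) = a \<odot>\<^bsub>E\<^esub> x \<oplus>\<^bsub>E\<^esub> a \<odot>\<^bsub>E\<^esub> y"
  using smult_r_distr[of a x y] by (simp add: scalar_ring_def)

lemma scalar_distrib_right: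
  "a \<in> K \<Longrightarrow> b \<in> K \<Longrightarrow> x \<in> carrier E \<Longrightarrow>
    (a + b) \<odot>\<^bsub>E\<^esub> x = a \<odot>\<^bsub>E\<^esub> x \<oplus>\<^bsub>E\<^esub> b \<odot>\<^bsub>E\<^esub> x"
  using smult_l_distr[of a b x] by (simp add: scalar_ring_def)

lemma scalar_assoc:
  "a \<in> K \<Longrightarrow> b \<in> K \<Longrightarrow> x \<in> carrier E \<Longrightarrow> (a * b) \<odot>\<^bsub>E\<^esub> x = a \<odot>\<^bsub>E\<^esub> (b \<odot>\<^bsub>E\<^esub> x)"
  using smult_assoc1[of a b x] by (simp add: scalar_ring_def)

lemma scalar_one [simp]: "x \<in> carrier E \<Longrightarrow> 1 \<odot>\<^bsub>E\<^esub> x = x"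
  using smult_one[of x] by (simp add: scalar_ring_def)

lemma scalar_zero [simp]: "x \<in> carrier E \<Longrightarrow> 0 \<odot>\<^bsub>E\<^esub> x = \<zero>\<^bsub>E\<^esub>"
  using smult_l_null[of x] by (simp add: scalar_ring_def)

lemma scalar_minus_one: "x \<in> carrier E \<Longrightarrow> (- 1) \<odot>\<^bsub>E\<^esub> x = \<ominus>\<^bsub>E\<^esub> x"
  using scalar_distrib_right[of "- 1" 1 x] of_real_scalar[of 1] minus_one_scalar
  by (simp add: M.minus_equality[symmetric])

section \<open>Sublinear functionals\<close>

definition sublinear :: "('a \<Rightarrow> real) \<Rightarrow> bool" where
  "sublinear p \<longleftrightarrow>
    (\<forall>x\<in>carrier E. \<forall>y\<in>carrier E. p (x \<oplus>\<^bsub>E\<^esub> y) \<le> p x + p y) \<and>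
    (\<forall>a\<ge>0. \<forall>x\<in>carrier E. p (of_real a \<odot>\<^bsub>E\<^esub> x) \<le> a * p x)"

text \<open>For sublinear \<open>p\<close>, this is the largest sublinear functional below
  \<open>p\<close> whose value at the negative of \<open>y\<close> is at most
  \<open>- p y\<close>.\<close>

definition directional :: "('a \<Rightarrow> real) \<Rightarrow> 'a \<Rightarrow> 'a \<Rightarrow> real" where
  "directional p y x = (INF t\<in>{0..}. p (x \<oplus>\<^bsub>E\<^esub> of_real t \<odot>\<^bsub>E\<^esub> y) - t * p y)"

lemma sublinear_add:
  "sublinear p \<Longrightarrow> x \<in> carrier E \<Longrightarrow> y \<in> carrier E \<Longrightarrow> p (x \<oplus>\<^bsub>E\<^esub> y) \<le> p x + p y"
  by (simp add: sublinear_def)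

lemma sublinear_scale:
  "sublinear p \<Longrightarrow> 0 \<le> a \<Longrightarrow> x \<in> carrier E \<Longrightarrow> p (of_real a \<odot>\<^bsub>E\<^esub> x) \<le> a * p x"
  by (simp add: sublinear_def)

lemma sublinear_zero:
  assumes "sublinear p"
  shows "p \<zero>\<^bsub>E\<^esub> = 0"
  using sublinear_scale[OF assms, of 0 "\<zero>\<^bsub>E\<^esub>"] sublinear_add[OF assms, of "\<zero>\<^bsub>E\<^esub>" "\<zero>\<^bsub>E\<^esub>"] by simp

lemma sublinear_minus_le:
  assumes "sublinear p" "x \<in> carrier E"
  shows "- p (\<ominus>\<^bsub>E\<^esub> x) \<le> p x"
  using sublinear_add[OF assms, of "\<ominus>\<^bsub>E\<^esub> x"] sublinear_zero[OF assms(1)] assms by (simp add: M.r_neg)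

lemma sublinear_scale_eq:
  assumes p: "sublinear p" and "0 \<le> a" and x: "x \<in> carrier E"
  shows "p (of_real a \<odot>\<^bsub>E\<^esub> x) = a * p x"
proof (cases "a = 0")
  case True
  then show ?thesis
    using x sublinear_zero[OF p] by simp
next
  case False
  then have "of_real (inverse a) \<odot>\<^bsub>E\<^esub> (of_real a \<odot>\<^bsub>E\<^esub> x) = x"
    using x scalar_assoc[OF of_real_scalar of_real_scalar x, of "inverse a" a] by simp
  then have "p x \<le> inverse a * p (of_real a \<odot>\<^bsub>E\<^esub> x)"
    using sublinear_scale[OF p, of "inverse a" "of_real a \<odot>\<^bsub>E\<^esub> x"] x \<open>0 \<le> a\<close> by simp
  then have "a * p x \<le> p (of_real a \<odot>\<^bsub>E\<^esub> x)"
    using False \<open>0 \<le> a\<close> by (simp add: field_simps)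
  then show ?thesis
    using sublinear_scale[OF p \<open>0 \<le> a\<close> x] by simp
qed

text \<open>Bounds the expressions in \<open>directional\<close> from below independently of
  \<open>t\<close>, so that their infimum is a genuine one.\<close>

lemma sublinear_lower:
  assumes p: "sublinear p" and [simp]: "x \<in> carrier E" "y \<in> carrier E" and "0 \<le> t"
  shows "- p (\<ominus>\<^bsub>E\<^esub> x) \<le> p (x \<oplus>\<^bsub>E\<^esub> of_real t \<odot>\<^bsub>E\<^esub> y) - t * p y"
proof -
  have "\<ominus>\<^bsub>E\<^esub> x \<oplus>\<^bsub>E\<^esub> (x \<oplus>\<^bsub>E\<^esub> of_real t \<odot>\<^bsub>E\<^esub> y) = of_real t \<odot>\<^bsub>E\<^esub> y"
    by (simp add: M.r_neg1)
  then show ?thesis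
    using sublinear_add[OF p, of "\<ominus>\<^bsub>E\<^esub> x" "x \<oplus>\<^bsub>E\<^esub> of_real t \<odot>\<^bsub>E\<^esub> y"]
      sublinear_scale_eq[OF p, of t y] assms
    by simp
qed

lemma directional_le:
  assumes p: "sublinear p" and x: "x \<in> carrier E" and y: "y \<in> carrier E" and "0 \<le> t"
  shows "directional p y x \<le> p (x \<oplus>\<^bsub>E\<^esub> of_real t \<odot>\<^bsub>E\<^esub> y) - t * p y"
  unfolding directional_def
proof (rule cINF_lower)
  show "bdd_below ((\<lambda>t. p (x \<oplus>\<^bsub>E\<^esub> of_real t \<odot>\<^bsub>E\<^esub> y) - t * p y) ` {0..})"
    using sublinear_lower[OF p x y] by (intro bdd_belowI[of _ "- p (\<ominus>\<^bsub>E\<^esub> x)"]) auto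
qed (use \<open>0 \<le> t\<close> in simp)

lemma directional_le_self:
  assumes "sublinear p" "x \<in> carrier E" "y \<in> carrier E"
  shows "directional p y x \<le> p x"
  using directional_le[OF assms, of 0] assms by simp

lemma le_directional:
  assumes "\<And>t. 0 \<le> t \<Longrightarrow> c \<le> p (x \<oplus>\<^bsub>E\<^esub> of_real t \<odot>\<^bsub>E\<^esub> y) - t * p y"
  shows "c \<le> directional p y x"
  unfolding directional_def by (rule cINF_greatest) (use assms in auto)

lemma sublinear_directional:
  assumes p: "sublinear p" and y [simp]: "y \<in> carrier E"
  shows "sublinear (directional p y)"
  unfolding sublinear_def
proof safe
  fix x x' assume [simp]: "x \<in> carrier E" "x' \<in> carrier E"
  \<comment> \<open>The parameters \<open>s\<close> for \<open>x\<close> and \<open>t\<close> for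
    \<open>x'\<close> are independent; their sum is the parameter for the sum of the vectors. The
    infima over \<open>s\<close> and over \<open>t\<close> are then taken one after the
    other.\<close>
  have "directional p y (x \<oplus>\<^bsub>E\<^esub> x') \<le>
      (p (x \<oplus>\<^bsub>E\<^esub> of_real s \<odot>\<^bsub>E\<^esub> y) - s * p y) + (p (x' \<oplus>\<^bsub>E\<^esub> of_real t \<odot>\<^bsub>E\<^esub> y) - t * p y)"
    if "0 \<le> s" "0 \<le> t" for s t
  proof -
    have "x \<oplus>\<^bsub>E\<^esub> x' \<oplus>\<^bsub>E\<^esub> of_real (s + t) \<odot>\<^bsub>E\<^esub> y =
        (x \<oplus>\<^bsub>E\<^esub> of_real s \<odot>\<^bsub>E\<^esub> y) \<oplus>\<^bsub>E\<^esub> (x' \<oplus>\<^bsub>E\<^esub> of_real t \<odot>\<^bsub>E\<^esub> y)"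
      by (simp add: scalar_distrib_right M.a_ac)
    then show ?thesis
      using directional_le[OF p _ y, of "x \<oplus>\<^bsub>E\<^esub> x'" "s + t"] that
        sublinear_add[OF p, of "x \<oplus>\<^bsub>E\<^esub> of_real s \<odot>\<^bsub>E\<^esub> y" "x' \<oplus>\<^bsub>E\<^esub> of_real t \<odot>\<^bsub>E\<^esub> y"]
      by (simp add: algebra_simps)
  qed
  then have "directional p y (x \<oplus>\<^bsub>E\<^esub> x') - (p (x' \<oplus>\<^bsub>E\<^esub> of_real t \<odot>\<^bsub>E\<^esub> y) - t * p y)
      \<le> directional p y x" if "0 \<le> t" for t
    using that by (intro le_directional) (simp add: algebra_simps)
  then have "directional p y (x \<oplus>\<^bsub>E\<^esub> x') - directional p y x \<le> directional p y x'"
    by (intro le_directional) (simp add: algebra_simps)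
  then show "directional p y (x \<oplus>\<^bsub>E\<^esub> x') \<le> directional p y x + directional p y x'"
    by simp
next
  fix a x assume a: "0 \<le> (a::real)" and [simp]: "x \<in> carrier E"
  \<comment> \<open>The parameter \<open>t\<close> for \<open>x\<close> corresponds to
    \<open>a * t\<close> for the multiple of \<open>x\<close>.\<close>
  have *: "directional p y (of_real a \<odot>\<^bsub>E\<^esub> x) \<le> a * (p (x \<oplus>\<^bsub>E\<^esub> of_real t \<odot>\<^bsub>E\<^esub> y) - t * p y)"
    if "0 \<le> t" for t
  proof -
    have "of_real a \<odot>\<^bsub>E\<^esub> x \<oplus>\<^bsub>E\<^esub> of_real (a * t) \<odot>\<^bsub>E\<^esub> y = of_real a \<odot>\<^bsub>E\<^esub> (x \<oplus>\<^bsub>E\<^esub> of_real t \<odot>\<^bsub>E\<^esub> y)"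
      by (simp add: scalar_distrib_left scalar_assoc)
    then show ?thesis
      using directional_le[OF p _ y, of "of_real a \<odot>\<^bsub>E\<^esub> x" "a * t"] a that
        sublinear_scale[OF p a, of "x \<oplus>\<^bsub>E\<^esub> of_real t \<odot>\<^bsub>E\<^esub> y"]
      by (simp add: algebra_simps)
  qed
  show "directional p y (of_real a \<odot>\<^bsub>E\<^esub> x) \<le> a * directional p y x"
  proof (cases "a = 0")
    case True
    then show ?thesis
      using *[of 0] by simp
  next
    case False
    then have "directional p y (of_real a \<odot>\<^bsub>E\<^esub> x) / a \<le> directional p y x"
      using a * by (intro le_directional) (simp add: field_simps)
    then show ?thesis
      using False a by (simp add: field_simps)
  qed
qed

text \<open>By Zorn's lemma: a nonempty chain of sublinear functionals below \<open>p\<close> has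
  its pointwise infimum as a lower bound of the same kind.\<close>

lemma ex_minimal_sublinear:
  assumes p: "sublinear p"
  shows "\<exists>q. sublinear q \<and> (\<forall>x\<in>carrier E. q x \<le> p x) \<and>
    (\<forall>q'. sublinear q' \<longrightarrow> (\<forall>x\<in>carrier E. q' x \<le> q x) \<longrightarrow> (\<forall>x\<in>carrier E. q' x = q x))"
proof -
  \<comment> \<open>Extensional functions make the pointwise order on the carrier
    antisymmetric.\<close>
  define A where "A = {q \<in> extensional (carrier E). sublinear q \<and> (\<forall>x\<in>carrier E. q x \<le> p x)}"
  \<comment> \<open>The order is reversed, since \<open>predicate_Zorn\<close> yields maximal
    elements.\<close>
  define P where "P = (\<lambda>f g. \<forall>x\<in>carrier E. g x \<le> (f x :: real))"
  have sub_restrict: "sublinear (restrict q (carrier E)) \<longleftrightarrow> sublinear q" for q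
    by (simp add: sublinear_def)
  have inA: "restrict p (carrier E) \<in> A"
    using p by (simp add: A_def sub_restrict)
  have "\<exists>q\<in>A. \<forall>q'\<in>A. P q q' \<longrightarrow> q' = q"
  proof (rule predicate_Zorn)
    show "partial_order_on A (relation_of P A)"
    proof (rule partial_order_on_relation_ofI)
      show "f = g" if "f \<in> A" "g \<in> A" "P f g" "P g f" for f g
        using that by (intro extensionalityI[of f "carrier E" g]) (auto simp: A_def P_def intro: order_antisym)
    qed (auto simp: P_def intro: order_trans)
  next
    fix C assume C: "C \<in> Chains (relation_of P A)"
    show "\<exists>q\<in>A. \<forall>f\<in>C. P f q"
    proof (cases "C = {}")
      case True
      then show ?thesis
        using inA by auto
    next
      case False
      have CA: "f \<in> A" if "f \<in> C" for f
        using C that by (auto simp: Chains_def relation_of_def)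
      have total: "P f g \<or> P g f" if "f \<in> C" "g \<in> C" for f g
        using C that by (auto simp: Chains_def relation_of_def)
      define q where "q = (\<lambda>x. INF f\<in>C. f x)"
      \<comment> \<open>The bound is common to all \<open>f\<close> of the chain: at the negative of
        \<open>x\<close>, \<open>f\<close> is at most \<open>p\<close>, and \<open>f x\<close> is at
        least minus the value of \<open>f\<close> there.\<close>
      have bdd: "bdd_below ((\<lambda>f. f x) ` C)" if "x \<in> carrier E" for x
      proof (rule bdd_belowI2)
        fix f assume "f \<in> C"
        then have f: "sublinear f" "\<forall>x\<in>carrier E. f x \<le> p x"
          using CA by (auto simp: A_def)
        show "- p (\<ominus>\<^bsub>E\<^esub> x) \<le> f x"
          using sublinear_minus_le[OF f(1) that] f(2)[rule_format, of "\<ominus>\<^bsub>E\<^esub> x"] that by simp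
      qed
      have q_le: "q x \<le> f x" if "f \<in> C" "x \<in> carrier E" for f x
        unfolding q_def by (rule cINF_lower[OF bdd]) (use that in auto)
      have le_q: "c \<le> q x" if "\<And>f. f \<in> C \<Longrightarrow> c \<le> f x" for c x
        unfolding q_def by (rule cINF_greatest) (use that False in auto)
      have "sublinear q"
        unfolding sublinear_def
      proof safe
        fix x y assume xy [simp]: "x \<in> carrier E" "y \<in> carrier E"
        have "q (x \<oplus>\<^bsub>E\<^esub> y) \<le> f x + g y" if "f \<in> C" "g \<in> C" for f g
        proof -
          \<comment> \<open>In a chain, the smaller of \<open>f\<close> and \<open>g\<close> serves
            both vectors at once.\<close>
          obtain h where h: "h \<in> C" "P f h" "P g h"
            using total[OF \<open>f \<in> C\<close> \<open>g \<in> C\<close>] \<open>f \<in> C\<close> \<open>g \<in> C\<close> by (auto simp: P_def)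
          then have "sublinear h"
            using CA by (simp add: A_def)
          moreover have "h x \<le> f x" "h y \<le> g y"
            using h xy by (simp_all add: P_def)
          ultimately show ?thesis
            using q_le[OF h(1), of "x \<oplus>\<^bsub>E\<^esub> y"] sublinear_add[of h x y] by simp
        qed
        then have "q (x \<oplus>\<^bsub>E\<^esub> y) - g y \<le> q x" if "g \<in> C" for g
          using that by (intro le_q) (simp add: algebra_simps)
        then have "q (x \<oplus>\<^bsub>E\<^esub> y) - q x \<le> q y"
          by (intro le_q) (simp add: algebra_simps)
        then show "q (x \<oplus>\<^bsub>E\<^esub> y) \<le> q x + q y"
          by simp
      next
        fix a x assume a: "0 \<le> (a::real)" and x: "x \<in> carrier E"
        have *: "q (of_real a \<odot>\<^bsub>E\<^esub> x) \<le> a * f x" if "f \<in> C" for f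
          using q_le[OF that, of "of_real a \<odot>\<^bsub>E\<^esub> x"] sublinear_scale[of f a x] a x CA[OF that]
          by (simp add: A_def)
        show "q (of_real a \<odot>\<^bsub>E\<^esub> x) \<le> a * q x"
        proof (cases "a = 0")
          case True
          then show ?thesis
            using * False by auto
        next
          case a0: False
          then have "q (of_real a \<odot>\<^bsub>E\<^esub> x) / a \<le> q x"
            using a * by (intro le_q) (simp add: field_simps)
          then show ?thesis
            using a0 a by (simp add: field_simps)
        qed
      qed
      moreover have "q x \<le> p x" if "x \<in> carrier E" for x
      proof -
        obtain f where f: "f \<in> C" using False by auto
        then have "f x \<le> p x"
          using CA[OF f] that by (simp add: A_def)
        then show ?thesis
          using q_le[OF f that] by simp
      qed
      ultimately have "restrict q (carrier E) \<in> A"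
        by (simp add: A_def sub_restrict)
      moreover have "P f (restrict q (carrier E))" if "f \<in> C" for f
        using q_le[OF that] by (simp add: P_def)
      ultimately show ?thesis
        by blast
    qed
  qed
  then obtain q where q: "q \<in> A" and min: "\<And>q'. q' \<in> A \<Longrightarrow> P q q' \<Longrightarrow> q' = q"
    by blast
  \<comment> \<open>Minimality within \<open>A\<close> extends to functionals that are arbitrary off
    the carrier.\<close>
  have "\<forall>x\<in>carrier E. q' x = q x" if q': "sublinear q'" "\<forall>x\<in>carrier E. q' x \<le> q x" for q'
  proof -
    have "\<forall>x\<in>carrier E. q' x \<le> p x"
      using q q'(2) by (fastforce simp: A_def intro: order_trans)
    then have "restrict q' (carrier E) = q"
      using q' by (intro min) (simp_all add: A_def P_def sub_restrict)
    then show ?thesis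
      by auto
  qed
  then show ?thesis
    using q by (intro exI[of _ q]) (simp add: A_def)
qed

section \<open>Norming functionals\<close>

lemma vnorm_zero [simp]: "vnorm E \<zero>\<^bsub>E\<^esub> = 0"
  using vnorm_eq_0[of "\<zero>\<^bsub>E\<^esub>"] by simp

lemma vnorm_minus [simp]: "x \<in> carrier E \<Longrightarrow> vnorm E (\<ominus>\<^bsub>E\<^esub> x) = vnorm E x"
  using vnorm_smult[of "- 1" x] by (simp add: scalar_minus_one)

lemma ex_norming_real_functional:
  assumes e: "e \<in> carrier E"
  shows "\<exists>\<psi>. (\<forall>x\<in>carrier E. \<forall>y\<in>carrier E. \<psi> (x \<oplus>\<^bsub>E\<^esub> y) = \<psi> x + \<psi> y) \<and>
    (\<forall>a. \<forall>x\<in>carrier E. \<psi> (of_real a \<odot>\<^bsub>E\<^esub> x) = a * \<psi> x) \<and>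
    (\<forall>x\<in>carrier E. \<bar>\<psi> x\<bar> \<le> vnorm E x) \<and> \<psi> e = vnorm E e"
proof -
  have norm: "sublinear (vnorm E)"
    by (simp add: sublinear_def vnorm_triangle vnorm_smult)
  obtain q where q: "sublinear q" "\<And>x. x \<in> carrier E \<Longrightarrow> q x \<le> directional (vnorm E) e x"
    and min: "\<And>q' x. sublinear q' \<Longrightarrow> \<forall>x\<in>carrier E. q' x \<le> q x \<Longrightarrow> x \<in> carrier E \<Longrightarrow> q' x = q x"
    using ex_minimal_sublinear[OF sublinear_directional[OF norm e]] by blast
  have le_norm: "q x \<le> vnorm E x" if "x \<in> carrier E" for x
    using q(2)[OF that] directional_le_self[OF norm that e] by simp
  have add: "q (x \<oplus>\<^bsub>E\<^esub> y) = q x + q y" if [simp]: "x \<in> carrier E" "y \<in> carrier E" for x y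
  proof -
    \<comment> \<open>By minimality of \<open>q\<close>. The parameter 1 in the infimum then bounds
      \<open>q x + q y\<close> by the value at the sum, which is the reverse of
      subadditivity.\<close>
    have "directional q y x = q x"
      by (rule min) (simp_all add: sublinear_directional directional_le_self q(1))
    then show ?thesis
      using directional_le[OF q(1), of x y 1] sublinear_add[OF q(1), of x y] by simp
  qed
  have minus: "q (\<ominus>\<^bsub>E\<^esub> x) = - q x" if "x \<in> carrier E" for x
    using add[of x "\<ominus>\<^bsub>E\<^esub> x"] that sublinear_zero[OF q(1)] by (simp add: M.r_neg)
  have scale: "q (of_real a \<odot>\<^bsub>E\<^esub> x) = a * q x" if x: "x \<in> carrier E" for a x
  proof (cases "0 \<le> a")
    case True
    then show ?thesis
      using sublinear_scale_eq[OF q(1) _ x] by simp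
  next
    case False
    have "of_real a \<odot>\<^bsub>E\<^esub> x = \<ominus>\<^bsub>E\<^esub> (of_real (- a) \<odot>\<^bsub>E\<^esub> x)"
      using scalar_assoc[OF minus_one_scalar of_real_scalar x, of "- a"]
        scalar_minus_one[OF scalar_closed[OF of_real_scalar x], of "- a"] by simp
    then show ?thesis
      using sublinear_scale_eq[OF q(1) _ x, of "- a"] minus x False by (simp del: of_real_minus)
  qed
  \<comment> \<open>The parameter 1 makes the vector inside the norm vanish. As \<open>q\<close> is
    odd, this is a lower bound for \<open>q e\<close>.\<close>
  have "q (\<ominus>\<^bsub>E\<^esub> e) \<le> - vnorm E e"
    using q(2)[of "\<ominus>\<^bsub>E\<^esub> e"] directional_le[OF norm _ e, of "\<ominus>\<^bsub>E\<^esub> e" 1] e by (simp add: M.l_neg)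
  then have "q e = vnorm E e"
    using minus[OF e] le_norm[OF e] by simp
  moreover have "\<bar>q x\<bar> \<le> vnorm E x" if "x \<in> carrier E" for x
    using le_norm[OF that] le_norm[of "\<ominus>\<^bsub>E\<^esub> x"] minus[OF that] that by simp
  ultimately show ?thesis
    using add scale by (intro exI[of _ q]) simp
qed

lemma ex_norming_functional:
  assumes e: "e \<in> carrier E"
  obtains \<phi> where "\<phi> \<in> dual_ball K E" "cmod (\<phi> e) = vnorm E e"
proof -
  obtain \<psi> where add: "\<And>x y. x \<in> carrier E \<Longrightarrow> y \<in> carrier E \<Longrightarrow> \<psi> (x \<oplus>\<^bsub>E\<^esub> y) = \<psi> x + \<psi> y"
    and scale: "\<And>a x. x \<in> carrier E \<Longrightarrow> \<psi> (of_real a \<odot>\<^bsub>E\<^esub> x) = a * \<psi> x"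
    and bound: "\<And>x. x \<in> carrier E \<Longrightarrow> \<bar>\<psi> x\<bar> \<le> vnorm E x" and \<psi>e: "\<psi> e = vnorm E e"
    using ex_norming_real_functional[OF e] by blast
  from scalars show thesis
  proof
    assume K: "K = \<real>"
    have real: "\<psi> (a \<odot>\<^bsub>E\<^esub> x) = Re a * \<psi> x" if "a \<in> \<real>" "x \<in> carrier E" for a x
      using scale[of x "Re a"] that by simp
    show thesis
    proof (rule that)
      show "complex_of_real \<circ> \<psi> \<in> dual_ball K E"
        using add bound real by (simp add: dual_ball_def K)
    qed (use e \<psi>e vnorm_nonneg in simp)
  next
    assume K: "K = UNIV"
    \<comment> \<open>The standard complex-linear functional with real part
      \<open>\<psi>\<close>.\<close>
    define \<phi> where "\<phi> = (\<lambda>x. Complex (\<psi> x) (- \<psi> (\<i> \<odot>\<^bsub>E\<^esub> x)))"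
    have [simp]: "a \<odot>\<^bsub>E\<^esub> x \<in> carrier E" if "x \<in> carrier E" for a x
      using that K by simp
    have \<psi>_smult: "\<psi> (a \<odot>\<^bsub>E\<^esub> x) = Re a * \<psi> x + Im a * \<psi> (\<i> \<odot>\<^bsub>E\<^esub> x)" if "x \<in> carrier E" for a x
    proof -
      have "a \<odot>\<^bsub>E\<^esub> x = (of_real (Re a) + of_real (Im a) * \<i>) \<odot>\<^bsub>E\<^esub> x"
        using complex_eq[of a] by (simp add: mult.commute)
      also have "\<dots> = of_real (Re a) \<odot>\<^bsub>E\<^esub> x \<oplus>\<^bsub>E\<^esub> of_real (Im a) \<odot>\<^bsub>E\<^esub> (\<i> \<odot>\<^bsub>E\<^esub> x)"
        using that K by (simp add: scalar_distrib_right scalar_assoc)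
      finally show ?thesis
        using that by (simp add: add scale)
    qed
    have \<phi>_smult: "\<phi> (a \<odot>\<^bsub>E\<^esub> x) = a * \<phi> x" if "x \<in> carrier E" for a x
      using \<psi>_smult[OF that, of a] \<psi>_smult[OF that, of "\<i> * a"] that K
      by (simp add: \<phi>_def complex_eq_iff scalar_assoc)
    have \<phi>_bound: "cmod (\<phi> x) \<le> vnorm E x" if x: "x \<in> carrier E" for x
    proof (cases "\<phi> x = 0")
      case True
      then show ?thesis
        using vnorm_nonneg[OF x] by simp
    next
      case False
      \<comment> \<open>A unimodular factor rotating \<open>\<phi> x\<close> onto the positive axis,
        where the modulus equals the real part and the bound for \<open>\<psi>\<close>
        applies.\<close>
      define w where "w = cnj (\<phi> x) / of_real (cmod (\<phi> x))"
      have w: "w * \<phi> x = of_real (cmod (\<phi> x))" "cmod w = 1"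
        using False complex_norm_square[of "\<phi> x"]
        by (simp_all add: w_def norm_divide field_simps power2_eq_square)
      have "cmod (\<phi> x) = \<psi> (w \<odot>\<^bsub>E\<^esub> x)"
        using \<phi>_smult[OF x, of w] w by (simp add: \<phi>_def complex_eq_iff)
      also have "\<dots> \<le> vnorm E x"
        using bound[of "w \<odot>\<^bsub>E\<^esub> x"] x K w vnorm_smult[of w x] by simp
      finally show ?thesis .
    qed
    have \<phi>_add: "\<phi> (x \<oplus>\<^bsub>E\<^esub> y) = \<phi> x + \<phi> y" if "x \<in> carrier E" "y \<in> carrier E" for x y
      using that by (simp add: \<phi>_def complex_eq_iff scalar_distrib_left[of \<i> x y] K add)
    have "\<phi> \<in> dual_ball K E"
      by (simp add: dual_ball_def K \<phi>_add \<phi>_smult \<phi>_bound)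
    then show thesis
    proof (rule that)
      \<comment> \<open>The real part of \<open>\<phi> e\<close> is already
        \<open>vnorm E e\<close>, so the modulus is no smaller; by \<open>\<phi>_bound\<close> it is
        no larger.\<close>
      show "cmod (\<phi> e) = vnorm E e"
        using \<phi>_bound[OF e] abs_Re_le_cmod[of "\<phi> e"] \<psi>e vnorm_nonneg[OF e] by (simp add: \<phi>_def)
    qed
  qed
qed

end

lemma scalar_normed_space_banach:
  assumes "K = \<real> \<or> K = UNIV" "banach_space K E"
  shows "scalar_normed_space K E"
  using assms by (simp add: scalar_normed_space_def scalar_normed_space_axioms_def banach_space_def)

section \<open>Weakly summable sequences\<close>

text \<open>Both sums are normalised to 1. Young's inequality with the weights \<open>r / t\<close>
  and \<open>r / u\<close>, which add up to 1, then applies termwise.\<close>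

lemma Holder_sum_powr:
  fixes a f :: "'i \<Rightarrow> real"
  assumes "finite I" and pos: "0 < r" "0 < t" "0 < u" and exps: "1 / r = 1 / t + 1 / u"
    and a: "\<And>i. i \<in> I \<Longrightarrow> 0 \<le> a i" and f: "\<And>i. i \<in> I \<Longrightarrow> 0 \<le> f i"
  shows "(\<Sum>i\<in>I. (a i * f i) powr r) powr (1 / r)
    \<le> (\<Sum>i\<in>I. a i powr t) powr (1 / t) * (\<Sum>i\<in>I. f i powr u) powr (1 / u)"
proof -
  define A B where "A = (\<Sum>i\<in>I. a i powr t)" and "B = (\<Sum>i\<in>I. f i powr u)"
  have nonneg: "0 \<le> A" "0 \<le> B"
    by (simp_all add: A_def B_def sum_nonneg)
  show ?thesis
  proof (cases "A = 0 \<or> B = 0")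
    \<comment> \<open>Normalisation is impossible here, but then every product vanishes.\<close>
    case True
    then have "\<forall>i\<in>I. a i * f i = 0"
      using \<open>finite I\<close> by (auto simp: A_def B_def sum_nonneg_eq_0_iff)
    then have "(\<Sum>i\<in>I. (a i * f i) powr r) = 0"
      by (intro sum.neutral) auto
    then show ?thesis
      by simp
  next
    case False
    with nonneg have AB: "0 < A" "0 < B"
      by auto
    have rtu: "r / t + r / u = 1"
      using pos arg_cong[OF exps, of "\<lambda>z. r * z"] by (simp add: distrib_left)
    have "(a i * f i) powr r
        \<le> A powr (r / t) * B powr (r / u) * (r / t * (a i powr t / A) + r / u * (f i powr u / B))"
      if i: "i \<in> I" for i
    proof (cases "a i = 0 \<or> f i = 0")
      case True
      then show ?thesis
        using AB pos by auto
    next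
      case False
      then have af: "0 < a i" "0 < f i"
        using a[OF i] f[OF i] by auto
      have "(a i powr t / A) powr (r / t) * (f i powr u / B) powr (r / u)
          \<le> r / t * (a i powr t / A) + r / u * (f i powr u / B)"
        by (rule Youngs_inequality_0) (use AB af pos rtu in auto)
      moreover have "(a i powr t / A) powr (r / t) * (f i powr u / B) powr (r / u)
          = (a i * f i) powr r / (A powr (r / t) * B powr (r / u))"
        using AB af pos by (simp add: powr_divide powr_powr powr_mult)
      ultimately show ?thesis
        using AB by (simp add: pos_divide_le_eq mult.commute)
    qed
    then have "(\<Sum>i\<in>I. (a i * f i) powr r)
        \<le> (\<Sum>i\<in>I. A powr (r / t) * B powr (r / u) * (r / t * (a i powr t / A) + r / u * (f i powr u / B)))"
      by (rule sum_mono)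
    also have "\<dots> = A powr (r / t) * B powr (r / u) * (r / t * (A / A) + r / u * (B / B))"
      unfolding A_def B_def
      by (simp only: sum_distrib_left[symmetric] sum.distrib sum_divide_distrib[symmetric])
    also have "\<dots> = A powr (r / t) * B powr (r / u)"
      using AB rtu by simp
    finally have "(\<Sum>i\<in>I. (a i * f i) powr r) powr (1 / r) \<le> (A powr (r / t) * B powr (r / u)) powr (1 / r)"
      using pos by (intro powr_mono2) (auto intro: sum_nonneg)
    also have "\<dots> = A powr (1 / t) * B powr (1 / u)"
      using pos by (simp add: powr_mult powr_powr)
    finally show ?thesis
      by (simp add: A_def B_def)
  qed
qed

section \<open>Weak norms of sequences and of their scalar multiples\<close>

context scalar_normed_space
begin

text \<open>Keeps the supremum in \<open>weak_norm\<close> from being one over the empty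
  set.\<close>

lemma zero_in_dual_ball: "(\<lambda>_. 0) \<in> dual_ball K E"
  using scalars by (auto simp: dual_ball_def vnorm_nonneg)

lemma le_weak_norm:
  assumes "x \<in> weak_lp K E p" "\<phi> \<in> dual_ball K E"
  shows "(\<Sum>j. cmod (\<phi> (x j)) powr p) powr (1 / p) \<le> weak_norm K E p x"
  unfolding weak_norm_def using assms by (intro cSUP_upper) (simp_all add: weak_lp_def)

lemma weak_norm_nonneg:
  assumes "x \<in> weak_lp K E p"
  shows "0 \<le> weak_norm K E p x"
  using le_weak_norm[OF assms zero_in_dual_ball] by simp

text \<open>Functionals vanish at zero, so each series is a finite sum; a bound uniform in the
  functional gives both the finiteness of the supremum and its size.\<close>

lemma weak_lp_finite_support:
  assumes x: "\<And>j. x j \<in> carrier E" and I: "finite I" "\<And>j. j \<notin> I \<Longrightarrow> x j = \<zero>\<^bsub>E\<^esub>"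
    and bound: "\<And>\<phi>. \<phi> \<in> dual_ball K E \<Longrightarrow> (\<Sum>j\<in>I. cmod (\<phi> (x j)) powr p) powr (1 / p) \<le> M"
  shows "x \<in> weak_lp K E p" "weak_norm K E p x \<le> M"
proof -
  have \<phi>0: "\<phi> (x j) = 0" if "\<phi> \<in> dual_ball K E" "j \<notin> I" for \<phi> j
    using that I(2)[of j] M.zero_closed by (force simp: dual_ball_def)
  have summable: "summable (\<lambda>j. cmod (\<phi> (x j)) powr p)" if "\<phi> \<in> dual_ball K E" for \<phi>
    by (rule summable_finite[OF I(1)]) (simp add: \<phi>0[OF that])
  have le: "(\<Sum>j. cmod (\<phi> (x j)) powr p) powr (1 / p) \<le> M" if "\<phi> \<in> dual_ball K E" for \<phi>
    using bound[OF that] suminf_finite[OF I(1), of "\<lambda>j. cmod (\<phi> (x j)) powr p"] \<phi>0[OF that] by simp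
  show "x \<in> weak_lp K E p"
    using x summable le by (auto simp: weak_lp_def intro!: bdd_aboveI2[of _ _ M])
  show "weak_norm K E p x \<le> M"
    unfolding weak_norm_def using zero_in_dual_ball le by (intro cSUP_least) auto
qed

text \<open>Hoelder's inequality for each functional separately: the factor coming from
  \<open>a\<close> is the same for all of them, so the supremum affects only the other one.\<close>

lemma weak_lp_scale:
  assumes x: "x \<in> weak_lp K E u" and pos: "0 < r" "0 < t" "0 < u" and exps: "1 / r = 1 / t + 1 / u"
    and I: "finite I" "\<And>j. j \<notin> I \<Longrightarrow> a j = 0" and a: "\<And>j. 0 \<le> a j"
  shows "(\<lambda>j. of_real (a j) \<odot>\<^bsub>E\<^esub> x j) \<in> weak_lp K E r" (is "?y \<in> _")
    and "weak_norm K E r (\<lambda>j. of_real (a j) \<odot>\<^bsub>E\<^esub> x j)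
      \<le> (\<Sum>j\<in>I. a j powr t) powr (1 / t) * weak_norm K E u x" (is "_ \<le> ?M")
proof -
  have xE: "x j \<in> carrier E" for j
    using x by (auto simp: weak_lp_def)
  have y0: "?y j = \<zero>\<^bsub>E\<^esub>" if "j \<notin> I" for j
    using I(2)[OF that] xE[of j] by simp
  have bound: "(\<Sum>j\<in>I. cmod (\<phi> (?y j)) powr r) powr (1 / r) \<le> ?M" if \<phi>: "\<phi> \<in> dual_ball K E" for \<phi>
  proof -
    have "cmod (\<phi> (?y j)) = a j * cmod (\<phi> (x j))" for j
      using \<phi> xE[of j] a[of j] by (simp add: dual_ball_def norm_mult)
    then have "(\<Sum>j\<in>I. cmod (\<phi> (?y j)) powr r) powr (1 / r)
        \<le> (\<Sum>j\<in>I. a j powr t) powr (1 / t) * (\<Sum>j\<in>I. cmod (\<phi> (x j)) powr u) powr (1 / u)"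
      using Holder_sum_powr[OF I(1) pos exps, of a "\<lambda>j. cmod (\<phi> (x j))"] a by simp
    also have "\<dots> \<le> (\<Sum>j\<in>I. a j powr t) powr (1 / t) * (\<Sum>j. cmod (\<phi> (x j)) powr u) powr (1 / u)"
      using x \<phi> I(1) pos
      by (intro mult_left_mono powr_mono2 sum_le_suminf) (auto simp: weak_lp_def intro: sum_nonneg)
    also have "\<dots> \<le> ?M"
      using le_weak_norm[OF x \<phi>] by (intro mult_left_mono) auto
    finally show ?thesis .
  qed
  show "?y \<in> weak_lp K E r" "weak_norm K E r ?y \<le> ?M"
    using weak_lp_finite_support[of ?y I r ?M] xE I(1) y0 bound by simp_all
qed

lemma ex_unit_vector:
  assumes "carrier E \<noteq> {\<zero>\<^bsub>E\<^esub>}"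
  obtains e where "e \<in> carrier E" "vnorm E e = 1"
proof -
  obtain x where x: "x \<in> carrier E" "x \<noteq> \<zero>\<^bsub>E\<^esub>"
    using assms M.zero_closed by blast
  then have pos: "0 < vnorm E x"
    using vnorm_nonneg[of x] vnorm_eq_0[of x] by simp
  show thesis
  proof (rule that)
    show "of_real (1 / vnorm E x) \<odot>\<^bsub>E\<^esub> x \<in> carrier E"
      using x by (intro scalar_closed of_real_scalar)
    show "vnorm E (of_real (1 / vnorm E x) \<odot>\<^bsub>E\<^esub> x) = 1"
      using x pos vnorm_smult[OF of_real_scalar, of x "1 / vnorm E x"] by (simp add: norm_divide)
  qed
qed

end

section \<open>Inclusion of summing classes\<close>

lemma multilinear_smult:
  assumes T: "T \<in> bounded_multilinear K m E F" and z: "z \<in> (\<Pi>\<^sub>E k\<in>{1..m}. carrier (E k))"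
    and "k \<in> {1..m}" "a \<in> K" "y \<in> carrier (E k)"
  shows "T (z(k := a \<odot>\<^bsub>E k\<^esub> y)) = a \<odot>\<^bsub>F\<^esub> T (z(k := y))"
  using assms unfolding bounded_multilinear_def by blast

lemma vnorm_multilinear_scale:
  assumes E: "\<And>k. k \<in> {1..m} \<Longrightarrow> scalar_normed_space K (E k)" and F: "scalar_normed_space K F"
    and T: "T \<in> bounded_multilinear K m E F"
    and x: "\<And>k. k \<in> {1..m} \<Longrightarrow> x k \<in> carrier (E k)"
  shows "vnorm F (T (\<lambda>k\<in>{1..m}. of_real (a k) \<odot>\<^bsub>E k\<^esub> x k)) =
    (\<Prod>k=1..m. \<bar>a k\<bar>) * vnorm F (T (\<lambda>k\<in>{1..m}. x k))"
proof -
  \<comment> \<open>Only the coordinates in \<open>S\<close> are scaled, so that the factors come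
    out one at a time by induction on \<open>S\<close>.\<close>
  define z where "z S = (\<lambda>k\<in>{1..m}. if k \<in> S then of_real (a k) \<odot>\<^bsub>E k\<^esub> x k else x k)" for S
  have "of_real (a k) \<odot>\<^bsub>E k\<^esub> x k \<in> carrier (E k)" if "k \<in> {1..m}" for k
    by (rule scalar_normed_space.scalar_closed[OF E scalar_normed_space.of_real_scalar[OF E] x]) (fact that)+
  then have z: "z S \<in> (\<Pi>\<^sub>E k\<in>{1..m}. carrier (E k))" for S
    using x by (auto simp: z_def)
  have TF: "T (z S) \<in> carrier F" for S
    using T z[of S] by (auto simp: bounded_multilinear_def)
  have "vnorm F (T (z S)) = (\<Prod>k\<in>S. \<bar>a k\<bar>) * vnorm F (T (z {}))" if "finite S" "S \<subseteq> {1..m}" for S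
    using that
  proof (induction S)
    case (insert k S)
    have "z (insert k S) = (z S)(k := of_real (a k) \<odot>\<^bsub>E k\<^esub> x k)" "(z S)(k := x k) = z S"
      using insert by (auto simp: z_def fun_eq_iff)
    then have "T (z (insert k S)) = of_real (a k) \<odot>\<^bsub>F\<^esub> T (z S)"
      using multilinear_smult[OF T z[of S], of k "of_real (a k)" "x k"] insert.prems x
        scalar_normed_space.of_real_scalar[OF F] by simp
    moreover have "vnorm F (of_real (a k) \<odot>\<^bsub>F\<^esub> T (z S)) = \<bar>a k\<bar> * vnorm F (T (z S))"
      using normed_space.vnorm_smult[OF scalar_normed_space.axioms(1)[OF F]
          scalar_normed_space.of_real_scalar[OF F] TF]
      by simp
    ultimately show ?case
      using insert by simp
  qed simp
  from this[of "{1..m}"] show ?thesis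
    by (simp add: z_def cong: restrict_cong)
qed

text \<open>The scaling argument with general exponents. Each of the \<open>m\<close> arguments pays
  \<open>1 / t = 1 / p - 1 / u\<close> for the weaker hypothesis on its sequence, which lowers
  \<open>1 / q\<close> to \<open>1 / s\<close>. The constant survives because the surplus power of
  \<open>B\<close> cancels exactly.\<close>

lemma summing_bound_inclusion:
  fixes p q s t u C :: real
  assumes E: "\<And>k. k \<in> {1..m} \<Longrightarrow> scalar_normed_space K (E k)" and F: "scalar_normed_space K F"
    and T: "T \<in> bounded_multilinear K m E F" and bound: "summing_bound K m E F q p T C" and "0 \<le> C"
    and pos: "0 < p" "0 < q" "0 < s" "0 < t" "0 < u"
    and ptu: "1 / p = 1 / t + 1 / u" and qst: "1 / q = 1 / s + m / t"
  shows "summing_bound K m E F s u T C"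
  unfolding summing_bound_def
proof (intro allI impI)
  fix x assume "\<forall>k\<in>{1..m}. x k \<in> weak_lp K (E k) u"
  then have x: "x k \<in> weak_lp K (E k) u" if "k \<in> {1..m}" for k
    using that by blast
  then have xE: "x k i \<in> carrier (E k)" if "k \<in> {1..m}" for k i
    using that by (force simp: weak_lp_def)
  define b where "b j = vnorm F (T (\<lambda>k\<in>{1..m}. x k (j k)))" for j
  define W where "W = (\<Prod>k=1..m. weak_norm K (E k) u (x k))"
  have b_nonneg: "0 \<le> b j" for j
  proof -
    have "T (\<lambda>k\<in>{1..m}. x k (j k)) \<in> carrier F"
      using T xE by (force simp: bounded_multilinear_def)
    then show ?thesis
      unfolding b_def by (rule normed_space.vnorm_nonneg[OF scalar_normed_space.axioms(1)[OF F]])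
  qed
  have W_nonneg: "0 \<le> W"
    unfolding W_def by (intro prod_nonneg) (use E x scalar_normed_space.weak_norm_nonneg in blast)
  \<comment> \<open>A bound uniform over finite \<open>J\<close> gives both summability and the
    estimate of the infinite sum.\<close>
  have key: "(\<Sum>j\<in>J. b j powr s) \<le> (C * W) powr s"
    if J: "finite J" "J \<subseteq> {1..m} \<rightarrow>\<^sub>E UNIV" for J :: "(nat \<Rightarrow> nat) set"
  proof -
    define B where "B = (\<Sum>j\<in>J. b j powr s)"
    \<comment> \<open>The marginals of \<open>b j powr s\<close>: for each \<open>k\<close> they add
      up to \<open>B\<close>. Hence their \<open>t\<close>-th roots, used as factors, have norm
      \<open>B powr (1 / t)\<close> in l_t, whatever \<open>k\<close> is.\<close>
    define S where "S k i = (\<Sum>j | j \<in> J \<and> j k = i. b j powr s)" for k i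
    define a where "a k i = S k i powr (1 / t)" for k i
    define I where "I k = (\<lambda>j. j k) ` J" for k
    define y where "y k = (\<lambda>i. of_real (a k i) \<odot>\<^bsub>E k\<^esub> x k i)" for k
    define g where "g j = vnorm F (T (\<lambda>k\<in>{1..m}. y k (j k)))" for j
    have S_nonneg: "0 \<le> S k i" for k i
      by (simp add: S_def sum_nonneg)
    have B_nonneg: "0 \<le> B"
      by (simp add: B_def sum_nonneg)
    have a0: "a k i = 0" if "i \<notin> I k" for k i
    proof -
      have "S k i = 0"
        unfolding S_def by (rule sum.neutral) (use that in \<open>auto simp: I_def\<close>)
      then show ?thesis
        by (simp add: a_def)
    qed
    have sum_a: "(\<Sum>i\<in>I k. a k i powr t) = B" for k
      using S_nonneg pos sum.image_gen[OF J(1), of "\<lambda>j. b j powr s" "\<lambda>j. j k"]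
      by (simp add: a_def powr_powr B_def S_def I_def)
    have y: "y k \<in> weak_lp K (E k) p"
      and y_norm: "weak_norm K (E k) p (y k) \<le> B powr (1 / t) * weak_norm K (E k) u (x k)"
      if "k \<in> {1..m}" for k
      using scalar_normed_space.weak_lp_scale[OF E[OF that] x[OF that] pos(1,4,5) ptu, of "I k" "a k"]
        J(1) sum_a[of k] a0[of _ k] by (simp_all add: y_def I_def a_def)
    have "(\<lambda>j. g j powr q) summable_on ({1..m} \<rightarrow>\<^sub>E UNIV)"
      and le: "(\<Sum>\<^sub>\<infinity>j\<in>{1..m} \<rightarrow>\<^sub>E UNIV. g j powr q) powr (1 / q) \<le> C * (\<Prod>k=1..m. weak_norm K (E k) p (y k))"
      using bound y unfolding summing_bound_def g_def by blast+
    then have sum_g: "(\<Sum>j\<in>J. g j powr q) \<le> (\<Sum>\<^sub>\<infinity>j\<in>{1..m} \<rightarrow>\<^sub>E UNIV. g j powr q)"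
      using J by (intro finite_sum_le_infsum) auto
    have "b j powr s \<le> g j powr q" if j: "j \<in> J" for j
    proof (cases "b j = 0")
      case False
      then have bj: "0 < b j"
        using b_nonneg[of j] by simp
      \<comment> \<open>The marginal at \<open>j k\<close> has \<open>b j powr s\<close> among its
        nonnegative summands.\<close>
      have "b j powr (s / t) \<le> a k (j k)" for k
      proof -
        have "b j powr s \<le> S k (j k)"
          unfolding S_def using J(1) j by (intro member_le_sum) auto
        then have "(b j powr s) powr (1 / t) \<le> a k (j k)"
          unfolding a_def using pos by (intro powr_mono2) auto
        then show ?thesis
          by (simp add: powr_powr)
      qed
      then have "(\<Prod>k=1..m. b j powr (s / t)) \<le> (\<Prod>k=1..m. \<bar>a k (j k)\<bar>)"
        by (intro prod_mono) (auto intro: order_trans[OF _ abs_ge_self])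
      then have "b j powr (m * s / t) * b j \<le> (\<Prod>k=1..m. \<bar>a k (j k)\<bar>) * b j"
        using bj by (intro mult_right_mono) (simp_all add: powr_powr mult.commute flip: powr_realpow)
      also have "\<dots> = g j"
        using vnorm_multilinear_scale[OF E F T, of "\<lambda>k. x k (j k)" "\<lambda>k. a k (j k)"] xE
        by (simp add: b_def g_def y_def)
      finally have "(b j powr (m * s / t) * b j) powr q \<le> g j powr q"
        using bj pos by (intro powr_mono2) auto
      moreover have "b j powr (m * s / t) * b j = b j powr (m * s / t + 1)"
        using bj by (simp add: powr_add)
      \<comment> \<open>This is \<open>1 / q = 1 / s + m / t\<close> multiplied by
        \<open>q * s\<close>.\<close>
      moreover have "(m * s / t + 1) * q = s"
        using qst pos by (simp add: field_simps)
      ultimately show ?thesis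
        by (simp add: powr_powr)
    qed (use pos in simp)
    then have "B \<le> (\<Sum>j\<in>J. g j powr q)"
      unfolding B_def by (rule sum_mono)
    with sum_g have "B powr (1 / q) \<le> (\<Sum>\<^sub>\<infinity>j\<in>{1..m} \<rightarrow>\<^sub>E UNIV. g j powr q) powr (1 / q)"
      using B_nonneg pos by (intro powr_mono2) auto
    also note le
    also have "C * (\<Prod>k=1..m. weak_norm K (E k) p (y k))
        \<le> C * (\<Prod>k=1..m. B powr (1 / t) * weak_norm K (E k) u (x k))"
      using y_norm y E scalar_normed_space.weak_norm_nonneg \<open>0 \<le> C\<close>
      by (intro mult_left_mono prod_mono) blast+
    also have "\<dots> = (B powr (1 / t)) ^ m * (C * W)"
      by (simp add: prod.distrib W_def)
    finally have main: "B powr (1 / q) \<le> (B powr (1 / t)) ^ m * (C * W)" .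
    show ?thesis
    proof (cases "B = 0")
      case False
      then have "0 < B"
        using B_nonneg by simp
      have "(B powr (1 / t)) ^ m = B powr (m / t)"
        using \<open>0 < B\<close> by (simp add: powr_powr flip: powr_realpow)
      \<comment> \<open>Dividing \<open>main\<close> by \<open>B powr (m / t)\<close>, which is
        possible for positive \<open>B\<close>, leaves the exponent
        \<open>1 / q - m / t = 1 / s\<close> on the left.\<close>
      moreover have "B powr (1 / q) = B powr (m / t) * B powr (1 / s)"
        by (simp add: qst add.commute flip: powr_add)
      ultimately have "B powr (1 / s) \<le> C * W"
        using main \<open>0 < B\<close> by simp
      then have "(B powr (1 / s)) powr s \<le> (C * W) powr s"
        using pos by (intro powr_mono2) auto
      then show ?thesis
        using pos \<open>0 < B\<close> by (simp add: powr_powr flip: B_def)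
    qed (simp flip: B_def)
  qed
  have summable: "(\<lambda>j. b j powr s) summable_on ({1..m} \<rightarrow>\<^sub>E UNIV)"
    using key by (intro nonneg_bdd_above_summable_on bdd_aboveI2[where M = "(C * W) powr s"]) auto
  have "(\<Sum>\<^sub>\<infinity>j\<in>{1..m} \<rightarrow>\<^sub>E UNIV. b j powr s) powr (1 / s) \<le> ((C * W) powr s) powr (1 / s)"
    using key pos by (intro powr_mono2 infsum_le_finite_sums[OF summable] infsum_nonneg) auto
  also have "\<dots> = C * W"
    using pos \<open>0 \<le> C\<close> W_nonneg by (simp add: powr_powr)
  finally show "(\<lambda>j. vnorm F (T (\<lambda>k\<in>{1..m}. x k (j k))) powr s) summable_on ({1..m} \<rightarrow>\<^sub>E UNIV) \<and>
      (\<Sum>\<^sub>\<infinity>j\<in>{1..m} \<rightarrow>\<^sub>E UNIV. vnorm F (T (\<lambda>k\<in>{1..m}. x k (j k))) powr s) powr (1 / s)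
        \<le> C * (\<Prod>k=1..m. weak_norm K (E k) u (x k))"
    using summable by (simp add: b_def W_def)
qed

section \<open>Tensor products of functionals\<close>

text \<open>The restriction to the product of the carriers gives the value \<open>undefined\<close>
  elsewhere, as \<open>bounded_multilinear\<close> demands.\<close>

definition tensor_operator ::
  "nat \<Rightarrow> (nat \<Rightarrow> 'a normed_module) \<Rightarrow> 'b normed_module \<Rightarrow> (nat \<Rightarrow> 'a \<Rightarrow> complex) \<Rightarrow> 'b \<Rightarrow> (nat \<Rightarrow> 'a) \<Rightarrow> 'b"
  where "tensor_operator m E F \<phi> v =
    (\<lambda>x \<in> \<Pi>\<^sub>E k\<in>{1..m}. carrier (E k). (\<Prod>k=1..m. \<phi> k (x k)) \<odot>\<^bsub>F\<^esub> v)"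

lemma tensor_operator_multilinear:
  assumes E: "\<And>k. k \<in> {1..m} \<Longrightarrow> scalar_normed_space K (E k)" and F: "scalar_normed_space K F"
    and \<phi>: "\<And>k. k \<in> {1..m} \<Longrightarrow> \<phi> k \<in> dual_ball K (E k)" and v: "v \<in> carrier F" "vnorm F v = 1"
  shows "tensor_operator m E F \<phi> v \<in> bounded_multilinear K m E F"
    and "\<And>x. x \<in> (\<Pi>\<^sub>E k\<in>{1..m}. carrier (E k)) \<Longrightarrow>
      vnorm F (tensor_operator m E F \<phi> v x) = (\<Prod>k=1..m. cmod (\<phi> k (x k)))"
proof -
  let ?X = "\<Pi>\<^sub>E k\<in>{1..m}. carrier (E k)" and ?T = "tensor_operator m E F \<phi> v"
  interpret F: scalar_normed_space K F
    by (fact F)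
  have prod_K: "(\<Prod>k\<in>S. c k) \<in> K" if "\<And>k. k \<in> S \<Longrightarrow> c k \<in> K" for S and c :: "nat \<Rightarrow> complex"
    using F.scalars that by (auto intro: prod_in_Reals)
  have \<phi>K: "\<phi> k z \<in> K" if "k \<in> {1..m}" "z \<in> carrier (E k)" for k z
    using \<phi>[OF that(1)] that(2) by (auto simp: dual_ball_def)
  have coeff: "(\<Prod>k=1..m. \<phi> k (x k)) \<in> K" if "x \<in> ?X" for x
    using that by (intro prod_K \<phi>K) auto
  show norm: "vnorm F (?T x) = (\<Prod>k=1..m. cmod (\<phi> k (x k)))" if "x \<in> ?X" for x
    using that v F.vnorm_smult[OF coeff[OF that] v(1)] by (simp add: tensor_operator_def prod_norm)
  \<comment> \<open>Isolating the factor of coordinate \<open>k\<close> reduces linearity of the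
    operator in that coordinate to linearity of \<open>\<phi> k\<close>.\<close>
  have upd: "?T (x(k := z)) = (\<phi> k z * (\<Prod>i\<in>{1..m} - {k}. \<phi> i (x i))) \<odot>\<^bsub>F\<^esub> v"
    if "x \<in> ?X" "k \<in> {1..m}" "z \<in> carrier (E k)" for x k z
  proof -
    have "x(k := z) \<in> ?X"
      using that by (auto simp: PiE_iff extensional_def)
    moreover have "(\<Prod>i=1..m. \<phi> i ((x(k := z)) i)) = \<phi> k z * (\<Prod>i\<in>{1..m} - {k}. \<phi> i (x i))"
      using that by (subst prod.remove[of _ k]) (auto intro!: prod.cong)
    ultimately show ?thesis
      by (simp add: tensor_operator_def)
  qed
  have rest: "(\<Prod>i\<in>{1..m} - {k}. \<phi> i (x i)) \<in> K" if "x \<in> ?X" for x k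
    using that by (intro prod_K \<phi>K) auto
  have K_mult: "a * b \<in> K" if "a \<in> K" "b \<in> K" for a b
    using F.scalars that by auto
  have "?T (x(k := y \<oplus>\<^bsub>E k\<^esub> z)) = ?T (x(k := y)) \<oplus>\<^bsub>F\<^esub> ?T (x(k := z))"
    if x: "x \<in> ?X" "k \<in> {1..m}" and yz: "y \<in> carrier (E k)" "z \<in> carrier (E k)" for x k y z
  proof -
    interpret Ek: scalar_normed_space K "E k"
      by (rule E[OF x(2)])
    have "\<phi> k (y \<oplus>\<^bsub>E k\<^esub> z) = \<phi> k y + \<phi> k z"
      using \<phi>[OF x(2)] yz by (simp add: dual_ball_def)
    then show ?thesis
      unfolding upd[OF x yz(1)] upd[OF x yz(2)] upd[OF x Ek.M.a_closed[OF yz]] distrib_right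
      by (simp only: F.scalar_distrib_right[OF K_mult K_mult v(1)] \<phi>K[OF x(2)] yz rest[OF x(1)] distrib_right)
  qed
  moreover have "?T (x(k := a \<odot>\<^bsub>E k\<^esub> y)) = a \<odot>\<^bsub>F\<^esub> ?T (x(k := y))"
    if x: "x \<in> ?X" "k \<in> {1..m}" and ay: "a \<in> K" "y \<in> carrier (E k)" for x k a y
  proof -
    interpret Ek: scalar_normed_space K "E k"
      by (rule E[OF x(2)])
    have "\<phi> k (a \<odot>\<^bsub>E k\<^esub> y) = a * \<phi> k y"
      using \<phi>[OF x(2)] ay by (simp add: dual_ball_def)
    then show ?thesis
      unfolding upd[OF x ay(2)] upd[OF x Ek.scalar_closed[OF ay]]
      by (simp only: mult.assoc F.scalar_assoc[OF ay(1) K_mult v(1)] \<phi>K[OF x(2) ay(2)] rest[OF x(1)])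
  qed
  moreover have "vnorm F (?T x) \<le> 1 * (\<Prod>k=1..m. vnorm (E k) (x k))" if "x \<in> ?X" for x
    using \<phi> that by (simp add: norm[OF that]) (intro prod_mono, auto simp: dual_ball_def PiE_iff)
  moreover have "?T \<in> ?X \<rightarrow>\<^sub>E carrier F"
    using coeff v by (auto simp: tensor_operator_def)
  ultimately show "?T \<in> bounded_multilinear K m E F"
    unfolding bounded_multilinear_def by blast
qed

text \<open>The norms of the values factor over the coordinates, so the multiple sum is dominated by
  a product of \<open>m\<close> single sums, each controlled by a weak norm.\<close>

lemma tensor_operator_summing_bound:
  assumes E: "\<And>k. k \<in> {1..m} \<Longrightarrow> scalar_normed_space K (E k)" and F: "scalar_normed_space K F"
    and \<phi>: "\<And>k. k \<in> {1..m} \<Longrightarrow> \<phi> k \<in> dual_ball K (E k)" and v: "v \<in> carrier F" "vnorm F v = 1"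
    and "0 < p"
  shows "summing_bound K m E F p p (tensor_operator m E F \<phi> v) 1"
  unfolding summing_bound_def
proof (intro allI impI)
  let ?T = "tensor_operator m E F \<phi> v"
  fix x assume "\<forall>k\<in>{1..m}. x k \<in> weak_lp K (E k) p"
  then have x: "x k \<in> weak_lp K (E k) p" if "k \<in> {1..m}" for k
    using that by blast
  then have xE: "x k i \<in> carrier (E k)" if "k \<in> {1..m}" for k i
    using that by (force simp: weak_lp_def)
  define f where "f k i = cmod (\<phi> k (x k i)) powr p" for k i
  define W where "W = (\<Prod>k=1..m. weak_norm K (E k) p (x k))"
  have f_nonneg: "0 \<le> f k i" for k i
    by (simp add: f_def)
  have f_sum: "(\<Sum>i\<in>I. f k i) \<le> weak_norm K (E k) p (x k) powr p" if k: "k \<in> {1..m}" "finite I" for k I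
  proof -
    have "summable (f k)"
      using x[OF k(1)] \<phi>[OF k(1)] by (simp add: weak_lp_def f_def[abs_def])
    then have "(\<Sum>i\<in>I. f k i) \<le> (\<Sum>i. f k i)"
      using k(2) by (intro sum_le_suminf) (auto simp: f_nonneg)
    \<comment> \<open>Restores the root taken in \<open>weak_norm\<close>, so that
      \<open>le_weak_norm\<close> applies.\<close>
    also have "\<dots> = ((\<Sum>i. f k i) powr (1 / p)) powr p"
      using \<open>0 < p\<close> \<open>summable (f k)\<close> by (simp add: powr_powr suminf_nonneg f_nonneg)
    also have "\<dots> \<le> weak_norm K (E k) p (x k) powr p"
      using \<open>0 < p\<close> scalar_normed_space.le_weak_norm[OF E x \<phi>, OF k(1) k(1) k(1)]
      by (intro powr_mono2) (auto simp flip: f_def)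
    finally show ?thesis .
  qed
  have term_eq: "vnorm F (?T (\<lambda>k\<in>{1..m}. x k (j k))) powr p = (\<Prod>k=1..m. f k (j k))" for j
  proof -
    have "(\<lambda>k\<in>{1..m}. x k (j k)) \<in> (\<Pi>\<^sub>E k\<in>{1..m}. carrier (E k))"
      using xE by auto
    from tensor_operator_multilinear(2)[OF E F \<phi> v this] show ?thesis
      by (simp add: f_def prod_powr_distrib)
  qed
  have key: "(\<Sum>j\<in>J. \<Prod>k=1..m. f k (j k)) \<le> W powr p"
    if J: "finite J" "J \<subseteq> {1..m} \<rightarrow>\<^sub>E UNIV" for J :: "(nat \<Rightarrow> nat) set"
  proof -
    \<comment> \<open>\<open>J\<close> is enlarged to the box of its projections, over which the sum
      of products is a product of sums.\<close>
    have "(\<Sum>j\<in>J. \<Prod>k=1..m. f k (j k))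
        \<le> (\<Sum>j\<in>(\<Pi>\<^sub>E k\<in>{1..m}. (\<lambda>j. j k) ` J). \<Prod>k=1..m. f k (j k))"
      using J by (intro sum_mono2 finite_PiE) (auto simp: f_def prod_nonneg PiE_iff subset_iff)
    also have "\<dots> = (\<Prod>k=1..m. \<Sum>i\<in>(\<lambda>j. j k) ` J. f k i)"
      using J by (subst prod_sum_PiE) auto
    also have "\<dots> \<le> (\<Prod>k=1..m. weak_norm K (E k) p (x k) powr p)"
      using J f_sum by (intro prod_mono) (auto simp: f_def intro: sum_nonneg)
    also have "\<dots> = W powr p"
      unfolding W_def by (rule prod_powr_distrib[symmetric])
    finally show ?thesis .
  qed
  have W_nonneg: "0 \<le> W"
    unfolding W_def by (intro prod_nonneg) (use E x scalar_normed_space.weak_norm_nonneg in blast)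
  have summable: "(\<lambda>j. \<Prod>k=1..m. f k (j k)) summable_on ({1..m} \<rightarrow>\<^sub>E UNIV)"
    using key by (intro nonneg_bdd_above_summable_on bdd_aboveI2[where M = "W powr p"])
      (auto simp: f_def prod_nonneg)
  have "(\<Sum>\<^sub>\<infinity>j\<in>{1..m} \<rightarrow>\<^sub>E UNIV. \<Prod>k=1..m. f k (j k)) powr (1 / p) \<le> (W powr p) powr (1 / p)"
    using key \<open>0 < p\<close> by (intro powr_mono2 infsum_le_finite_sums[OF summable] infsum_nonneg)
      (auto simp: f_def prod_nonneg)
  also have "\<dots> = W"
    using \<open>0 < p\<close> W_nonneg by (simp add: powr_powr)
  finally show "(\<lambda>j. vnorm F (?T (\<lambda>k\<in>{1..m}. x k (j k))) powr p) summable_on ({1..m} \<rightarrow>\<^sub>E UNIV) \<and>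
      (\<Sum>\<^sub>\<infinity>j\<in>{1..m} \<rightarrow>\<^sub>E UNIV. vnorm F (?T (\<lambda>k\<in>{1..m}. x k (j k))) powr p) powr (1 / p)
        \<le> 1 * (\<Prod>k=1..m. weak_norm K (E k) p (x k))"
    using summable by (simp only: term_eq W_def mult_1)
qed

text \<open>The inequality is tested on sequences with \<open>e k\<close> at index 0 and zero
  elsewhere: their weak norms are at most 1, and the multi-index 0 alone contributes 1.\<close>

lemma tensor_operator_summing_bound_ge_1:
  assumes E: "\<And>k. k \<in> {1..m} \<Longrightarrow> scalar_normed_space K (E k)" and F: "scalar_normed_space K F"
    and \<phi>: "\<And>k. k \<in> {1..m} \<Longrightarrow> \<phi> k \<in> dual_ball K (E k)" and v: "v \<in> carrier F" "vnorm F v = 1"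
    and e: "\<And>k. k \<in> {1..m} \<Longrightarrow> e k \<in> carrier (E k) \<and> vnorm (E k) (e k) = 1 \<and> cmod (\<phi> k (e k)) = 1"
    and "0 < u" "0 < s" "0 < C" and bound: "summing_bound K m E F s u (tensor_operator m E F \<phi> v) C"
  shows "1 \<le> C"
proof -
  let ?T = "tensor_operator m E F \<phi> v"
  define x where "x k i = (if i = 0 then e k else \<zero>\<^bsub>E k\<^esub>)" for k and i :: nat
  have x: "x k \<in> weak_lp K (E k) u" and x_norm: "weak_norm K (E k) u (x k) \<le> 1"
    if k: "k \<in> {1..m}" for k
  proof -
    interpret Ek: scalar_normed_space K "E k"
      by (rule E[OF k])
    have "cmod (\<psi> (e k)) \<le> 1" if "\<psi> \<in> dual_ball K (E k)" for \<psi>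
      using that e[OF k] by (force simp: dual_ball_def)
    then have "(\<Sum>j\<in>{0}. cmod (\<psi> (x k j)) powr u) powr (1 / u) \<le> 1" if "\<psi> \<in> dual_ball K (E k)" for \<psi>
      using that \<open>0 < u\<close> by (simp add: x_def powr_powr)
    then show "x k \<in> weak_lp K (E k) u" "weak_norm K (E k) u (x k) \<le> 1"
      using e[OF k] Ek.weak_lp_finite_support[of "x k" "{0}" u 1] by (simp_all add: x_def)
  qed
  define g where "g j = vnorm F (?T (\<lambda>k\<in>{1..m}. x k (j k))) powr s" for j
  have "g summable_on ({1..m} \<rightarrow>\<^sub>E UNIV)"
    and le: "(\<Sum>\<^sub>\<infinity>j\<in>{1..m} \<rightarrow>\<^sub>E UNIV. g j) powr (1 / s) \<le> C * (\<Prod>k=1..m. weak_norm K (E k) u (x k))"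
    using bound x unfolding summing_bound_def g_def by blast+
  then have "sum g {\<lambda>k\<in>{1..m}. 0} \<le> (\<Sum>\<^sub>\<infinity>j\<in>{1..m} \<rightarrow>\<^sub>E UNIV. g j)"
    by (intro finite_sum_le_infsum) (auto simp: g_def)
  moreover have "g (\<lambda>k\<in>{1..m}. 0) = 1"
  proof -
    have "(\<lambda>k\<in>{1..m}. e k) \<in> (\<Pi>\<^sub>E k\<in>{1..m}. carrier (E k))"
      using e by auto
    from tensor_operator_multilinear(2)[OF E F \<phi> v this]
    have "vnorm F (?T (\<lambda>k\<in>{1..m}. e k)) = 1"
      using e by simp
    then show ?thesis
      by (simp add: g_def x_def cong: restrict_cong)
  qed
  ultimately have "1 powr (1 / s) \<le> (\<Sum>\<^sub>\<infinity>j\<in>{1..m} \<rightarrow>\<^sub>E UNIV. g j) powr (1 / s)"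
    using \<open>0 < s\<close> by (intro powr_mono2) auto
  also note le
  also have "C * (\<Prod>k=1..m. weak_norm K (E k) u (x k)) \<le> C * 1"
    using x_norm x E scalar_normed_space.weak_norm_nonneg \<open>0 < C\<close>
    by (intro mult_left_mono prod_le_1) (auto, blast)
  finally show ?thesis
    by simp
qed

section \<open>The norm of the inclusion\<close>

lemma summing_norm_le:
  assumes "0 < C" "summing_bound K m E F q p T C"
  shows "summing_norm K m E F q p T \<le> C"
  unfolding summing_norm_def using assms by (intro cInf_lower bdd_belowI[of _ 0]) auto

text \<open>Membership in the class provides an admissible constant, so that the infimum is over a
  nonempty set.\<close>

lemma summing_norm_ge:
  assumes "T \<in> multiple_summing K m E F q p"
    and "\<And>C. 0 < C \<Longrightarrow> summing_bound K m E F q p T C \<Longrightarrow> c \<le> C"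
  shows "c \<le> summing_norm K m E F q p T"
  unfolding summing_norm_def using assms by (intro cInf_greatest) (auto simp: multiple_summing_def)

theorem proposition3p3:
  fixes K :: "complex set" and m :: nat and r u :: real
    and E :: "nat \<Rightarrow> 'a normed_module" and F :: "'b normed_module"
  assumes "K = \<real> \<or> K = UNIV"
    and "m \<ge> 2"
    and "2 \<le> r" and "r \<le> u" and "u < real m * r / (real m - 1)"
    and "\<And>k. k \<in> {1..m} \<Longrightarrow> banach_space K (E k)"
    and "banach_space K F"
  shows "let s = r * u / (real m * r - (real m - 1) * u) in
    multiple_summing K m E F r r \<subseteq> multiple_summing K m E F s u
    \<and> inclusion_norm K m E F r r s u \<le> 1
    \<and> ((\<forall>k\<in>{1..m}. carrier (E k) \<noteq> {\<zero>\<^bsub>E k\<^esub>}) \<and> carrier F \<noteq> {\<zero>\<^bsub>F\<^esub>}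
        \<longrightarrow> inclusion_norm K m E F r r s u = 1)"
proof -
  \<comment> \<open>Positivity of \<open>D\<close> is the assumed upper bound on
    \<open>u\<close>.\<close>
  define D where "D = real m * r - (real m - 1) * u"
  define s where "s = r * u / D"
  have E: "scalar_normed_space K (E k)" if "k \<in> {1..m}" for k
    using scalar_normed_space_banach assms(1,6) that by blast
  have F: "scalar_normed_space K F"
    using scalar_normed_space_banach assms(1,7) by blast
  have pos: "0 < r" "0 < u" "0 < D"
    using assms(2-5) by (simp_all add: D_def field_simps)
  then have "0 < s"
    by (simp add: s_def)
  have bound: "summing_bound K m E F s u T C"
    if T: "T \<in> bounded_multilinear K m E F" "0 < C" "summing_bound K m E F r r T C" for T C
  proof (cases "r = u")
    \<comment> \<open>Here \<open>1 / t\<close> would be 0; the two classes coincide.\<close>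
    case True
    then have "s = r"
      using pos by (simp add: s_def D_def algebra_simps)
    then show ?thesis
      using that True by simp
  next
    case False
    \<comment> \<open>The solution of \<open>1 / t = 1 / r - 1 / u\<close>.\<close>
    define t where "t = r * u / (u - r)"
    have "0 < t"
      using False assms(4) pos by (simp add: t_def)
    \<comment> \<open>By definition \<open>1 / s\<close> is \<open>m / u - (m - 1) / r\<close>, that
      is, \<open>1 / r - m * (1 / r - 1 / u)\<close>. This explains the exponent
      \<open>s\<close>.\<close>
    moreover have "1 / r = 1 / t + 1 / u" "1 / r = 1 / s + real m / t"
      using pos by (simp_all add: t_def s_def D_def field_simps)
    ultimately show ?thesis
      using summing_bound_inclusion[OF E F T(1,3)] T(2) pos \<open>0 < s\<close> by simp
  qed
  have subset: "multiple_summing K m E F r r \<subseteq> multiple_summing K m E F s u"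
    using bound by (auto simp: multiple_summing_def)
  \<comment> \<open>Every constant admissible for \<open>(r;r)\<close> is admissible for
    \<open>(s;u)\<close>, so the infimum can only decrease.\<close>
  have norm_mono: "summing_norm K m E F s u T \<le> summing_norm K m E F r r T"
    if T: "T \<in> multiple_summing K m E F r r" for T
    using T bound by (intro summing_norm_ge[OF T] summing_norm_le) (auto simp: multiple_summing_def)
  then have le: "inclusion_norm K m E F r r s u \<le> 1"
    unfolding inclusion_norm_def by (intro SUP_least) (force simp: ennreal_le_1 intro: order_trans)
  \<comment> \<open>If one of the spaces is zero, the zero operator is the only one and the norm of
    the inclusion is 0; hence the nontriviality condition.\<close>
  have "inclusion_norm K m E F r r s u = 1"
    if nontrivial: "\<forall>k\<in>{1..m}. carrier (E k) \<noteq> {\<zero>\<^bsub>E k\<^esub>}" "carrier F \<noteq> {\<zero>\<^bsub>F\<^esub>}"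
  proof -
    have "\<exists>\<phi> e. \<phi> \<in> dual_ball K (E k) \<and> e \<in> carrier (E k) \<and> vnorm (E k) e = 1 \<and> cmod (\<phi> e) = 1"
      if k: "k \<in> {1..m}" for k
    proof -
      interpret Ek: scalar_normed_space K "E k"
        by (rule E[OF k])
      obtain e where e: "e \<in> carrier (E k)" "vnorm (E k) e = 1"
        using Ek.ex_unit_vector nontrivial(1) k by blast
      then show ?thesis
        using Ek.ex_norming_functional[OF e(1)] by metis
    qed
    then obtain \<phi> e where \<phi>: "\<And>k. k \<in> {1..m} \<Longrightarrow> \<phi> k \<in> dual_ball K (E k)"
      and e: "\<And>k. k \<in> {1..m} \<Longrightarrow> e k \<in> carrier (E k) \<and> vnorm (E k) (e k) = 1 \<and> cmod (\<phi> k (e k)) = 1"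
      by metis
    obtain v where v: "v \<in> carrier F" "vnorm F v = 1"
      using scalar_normed_space.ex_unit_vector[OF F nontrivial(2)] by blast
    define T where "T = tensor_operator m E F \<phi> v"
    have T_bound: "summing_bound K m E F r r T 1"
      unfolding T_def by (rule tensor_operator_summing_bound[OF E F \<phi> v pos(1)])
    have T: "T \<in> multiple_summing K m E F r r"
      using T_bound tensor_operator_multilinear(1)[OF E F \<phi> v]
      by (auto simp: multiple_summing_def T_def intro!: exI[of _ 1])
    have "1 \<le> summing_norm K m E F s u T"
    proof (rule summing_norm_ge)
      show "T \<in> multiple_summing K m E F s u"
        using T subset by blast
      show "1 \<le> C" if "0 < C" "summing_bound K m E F s u T C" for C
        using tensor_operator_summing_bound_ge_1[OF E F \<phi> v e pos(2) \<open>0 < s\<close> that(1)] that(2)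
        by (simp add: T_def)
    qed
    then have "1 \<le> ennreal (summing_norm K m E F s u T)"
      by simp
    \<comment> \<open>The constant 1 puts \<open>T\<close> into the unit ball of the
      \<open>(r;r)\<close> class, over which the supremum is taken.\<close>
    also have "\<dots> \<le> inclusion_norm K m E F r r s u"
      unfolding inclusion_norm_def using T summing_norm_le[OF _ T_bound] by (intro SUP_upper) simp
    finally show ?thesis
      using le by (intro antisym)
  qed
  with subset le show ?thesis
    unfolding Let_def by (simp flip: D_def s_def)
qed

end
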